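(* Let $E$ be an element of a mesh satisfying the mesh assumptions (M1)-(M2). Then a virtual element function $v_h\in V_h(E)$ belongs to $\mathcal K_h(E)$ if and only if its values at the vertices of $E$ are nonnegative.
   Context: $E\subset\mathbb R^2$ is an open polygon with nonintersecting boundary $\partial E$ made of straight edges $e$, and diameter $h_E$. For a fixed $\rho>0$: (M1) $E$ is star-shaped with respect to a ball of radius greater than $\rho h_E$; (M2) every edge of $E$ has length at least $\rho h_E$. $\mathbb P_1(e)$ is the space of polynomials of degree at most $1$ on $e$. $V_h(E)=\{v_h\in H^1(E)\cap C(\overline E): v_h|_{\partial E}\in C(\partial E),\ v_h|_e\in\mathbb P_1(e)\ \forall e\subset\partial E,\ \Delta v_h=0\text{ in }E\}$ and $\mathcal K_h(E)=\{v_h\in V_h(E): v_h\ge0\text{ in }E\}$. *)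

theory Defs
  imports "HOL-Analysis.Analysis" "HOL-Computational_Algebra.Polynomial"
begin

fun polygonal_path :: "(real^2) list \<Rightarrow> real \<Rightarrow> real^2" where
  "polygonal_path [] = linepath 0 0"
| "polygonal_path [a] = linepath a a"
| "polygonal_path [a, b] = linepath a b"
| "polygonal_path (a # b # c # xs) = linepath a b +++ polygonal_path (b # c # xs)"

text \<open>A polygon is given by the cyclic list of its vertices. The vertices belong to the data,
  because consecutive edges may be collinear (straight angles are allowed).\<close>

definition boundary_path :: "(real^2) list \<Rightarrow> real \<Rightarrow> real^2" where
  "boundary_path ps = polygonal_path (ps @ [hd ps])"

definition edges :: "(real^2) list \<Rightarrow> ((real^2) \<times> (real^2)) set" where
  "edges ps = set (zip ps (rotate1 ps))"

text \<open>The parametrised boundary being a simple path excludes repeated vertices and any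
  intersection of edges other than the common endpoint of neighbours.\<close>

definition open_polygon :: "(real^2) set \<Rightarrow> (real^2) list \<Rightarrow> bool" where
  "open_polygon E ps \<longleftrightarrow>
     3 \<le> length ps \<and> simple_path (boundary_path ps) \<and> E = inside (path_image (boundary_path ps))"

definition star_shaped_wrt :: "'a::real_vector set \<Rightarrow> 'a set \<Rightarrow> bool" where
  "star_shaped_wrt E B \<longleftrightarrow> B \<subseteq> E \<and> (\<forall>y\<in>B. \<forall>x\<in>E. closed_segment y x \<subseteq> E)"

definition M1 :: "real \<Rightarrow> (real^2) set \<Rightarrow> bool" where
  "M1 \<rho> E \<longleftrightarrow> (\<exists>c r. r > \<rho> * diameter E \<and> star_shaped_wrt E (ball c r))"

definition M2 :: "real \<Rightarrow> (real^2) set \<Rightarrow> (real^2) list \<Rightarrow> bool" where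
  "M2 \<rho> E ps \<longleftrightarrow> (\<forall>(a, b)\<in>edges ps. dist a b \<ge> \<rho> * diameter E)"

definition partial :: "'n::finite \<Rightarrow> (real^'n \<Rightarrow> real) \<Rightarrow> real^'n \<Rightarrow> real" where
  "partial i f x = frechet_derivative f (at x) (axis i 1)"

definition laplacian :: "(real^'n::finite \<Rightarrow> real) \<Rightarrow> real^'n \<Rightarrow> real" where
  "laplacian f x = (\<Sum>i\<in>UNIV. partial i (partial i f) x)"

primrec C_k :: "nat \<Rightarrow> (real^'n::finite \<Rightarrow> real) \<Rightarrow> bool" where
  "C_k 0 f \<longleftrightarrow> continuous_on UNIV f"
| "C_k (Suc k) f \<longleftrightarrow> (\<forall>x. f differentiable (at x)) \<and> (\<forall>i. C_k k (partial i f))"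

definition test_functions :: "(real^'n::finite) set \<Rightarrow> (real^'n \<Rightarrow> real) set" where
  "test_functions E =
     {\<phi>. (\<forall>k. C_k k \<phi>) \<and> compact (closure {x. \<phi> x \<noteq> 0}) \<and> closure {x. \<phi> x \<noteq> 0} \<subseteq> E}"

definition L2 :: "(real^'n::finite) set \<Rightarrow> (real^'n \<Rightarrow> real) set" where
  "L2 E = {f. set_borel_measurable lebesgue E f \<and> set_integrable lebesgue E (\<lambda>x. (f x)\<^sup>2)}"

definition weak_partial ::
  "(real^'n::finite) set \<Rightarrow> 'n \<Rightarrow> (real^'n \<Rightarrow> real) \<Rightarrow> (real^'n \<Rightarrow> real) \<Rightarrow> bool" where
  "weak_partial E i v g \<longleftrightarrow>
     (\<forall>\<phi>\<in>test_functions E.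
        (LINT x:E|lebesgue. v x * partial i \<phi> x) = - (LINT x:E|lebesgue. g x * \<phi> x))"

definition H1 :: "(real^'n::finite) set \<Rightarrow> (real^'n \<Rightarrow> real) set" where
  "H1 E = {v. v \<in> L2 E \<and> (\<forall>i. \<exists>g\<in>L2 E. weak_partial E i v g)}"

text \<open>The equation \<open>\<Delta>v = 0\<close> in the sense of distributions; no second derivatives of \<open>v\<close> are
  presupposed.\<close>

definition harmonic_in :: "(real^'n::finite \<Rightarrow> real) \<Rightarrow> (real^'n) set \<Rightarrow> bool" where
  "harmonic_in v E \<longleftrightarrow> (\<forall>\<phi>\<in>test_functions E. (LINT x:E|lebesgue. v x * laplacian \<phi> x) = 0)"

text \<open>Restriction of \<open>v\<close> to the segment from \<open>a\<close> to \<open>b\<close> is a polynomial of degree at most one in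
  the affine parameter of the segment.\<close>

definition P1_on :: "(real^2 \<Rightarrow> real) \<Rightarrow> (real^2) \<times> (real^2) \<Rightarrow> bool" where
  "P1_on v = (\<lambda>(a, b). \<exists>p::real poly. degree p \<le> 1 \<and>
     (\<forall>t\<in>{0..1}. v (linepath a b t) = poly p t))"

text \<open>Elements are total functions of which only the values on \<open>closure E\<close> are relevant.
  Continuity up to the boundary selects the continuous representative of the Sobolev class.\<close>

definition V_h :: "(real^2) set \<Rightarrow> (real^2) list \<Rightarrow> (real^2 \<Rightarrow> real) set" where
  "V_h E ps = {v. v \<in> H1 E \<and> continuous_on (closure E) v \<and> continuous_on (frontier E) v \<and>
     (\<forall>e\<in>edges ps. P1_on v e) \<and> harmonic_in v E}"

definition K_h :: "(real^2) set \<Rightarrow> (real^2) list \<Rightarrow> (real^2 \<Rightarrow> real) set" where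
  "K_h E ps = {v \<in> V_h E ps. \<forall>x\<in>E. v x \<ge> 0}"

end

theory Submission imports Defs begin

text \<open>
  A function \<open>v\<close> of the local virtual element space is affine on each edge, so on the boundary it
  is a convex combination of vertex values, and nonnegative vertex values make it nonnegative on
  the whole boundary. It is harmonic and continuous up to the boundary, so the minimum principle
  carries this bound into \<open>E\<close>. Conversely, a function that is nonnegative in \<open>E\<close> is so on the
  closure, and by the Jordan curve theorem the vertices belong to the closure
  (\<open>frontier_inside_simple_closed_path\<close>).

  Harmonicity is meant in the sense of distributions, hence second derivatives of \<open>v\<close> cannot be
  used directly in the minimum principle (\<open>weak_minimum_principle\<close>). The proof averages \<open>v\<close> with
  translates of a smooth bump function (\<open>exists_smooth_bump\<close>, \<open>mollify\<close>). The averages \<open>V\<close> follow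
  \<open>v\<close> closely, and since each translate is a test function, the second differences
  \<open>V(y + h e\<^sub>i) + V(y - h e\<^sub>i) - 2 V(y)\<close>, summed over all axes, are \<open>o(h\<^sup>2)\<close>
  (\<open>mollify_second_differences\<close>). If \<open>v\<close> were negative somewhere, then \<open>V - \<epsilon> |y|\<^sup>2\<close> would have an
  interior minimum for a suitable small \<open>\<epsilon> > 0\<close>; there the same sum is at least \<open>2 n \<epsilon> h\<^sup>2\<close>, where
  \<open>n\<close> is the dimension, a contradiction.
\<close>

section \<open>Smooth bump functions\<close>

text \<open>The class of functions \<open>p (1/t) exp (-1/t)\<close>, extended by \<open>0\<close> to \<open>t \<le> 0\<close>. Admitting a
  polynomial factor makes the class closed under differentiation, so that infinite
  differentiability of \<open>exp (-1/t)\<close> comes out of a single first-order computation.\<close>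

definition flat_exp :: "real poly \<Rightarrow> real \<Rightarrow> real" where
  "flat_exp p t = (if t > 0 then poly p (1 / t) * exp (- (1 / t)) else 0)"

lemma tendsto_poly_times_exp_uminus_0:
  "((\<lambda>s::real. poly p s * exp (- s)) \<longlongrightarrow> 0) at_top"
proof -
  have "((\<lambda>s. \<Sum>i\<le>degree p. coeff p i * (s ^ i / exp s)) \<longlongrightarrow> (\<Sum>i\<le>degree p. coeff p i * 0)) at_top"
    by (intro tendsto_intros tendsto_power_div_exp_0)
  moreover have "(\<Sum>i\<le>degree p. coeff p i * (s ^ i / exp s)) = poly p s * exp (- s)" for s
    unfolding poly_altdef sum_distrib_right by (intro sum.cong) (auto simp: exp_minus field_simps)
  ultimately show ?thesis by simp
qed

text \<open>For \<open>t > 0\<close> this is the product rule, with \<open>d(1/t)/dt = -(1/t)\<^sup>2\<close>. At \<open>0\<close> the difference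
  quotient from the right is \<open>s p(s) exp (-s)\<close> with \<open>s = 1/h\<close>, again a polynomial times a
  decaying exponential.\<close>

lemma has_real_derivative_flat_exp:
  "(flat_exp p has_real_derivative flat_exp (monom 1 2 * (p - pderiv p)) t) (at t)"
proof -
  consider "t > 0" | "t < 0" | "t = 0" by linarith
  then show ?thesis
  proof cases
    case 1
    have "((\<lambda>t. poly p (1 / t) * exp (- (1 / t))) has_real_derivative
        flat_exp (monom 1 2 * (p - pderiv p)) t) (at t)"
      using 1 by (auto intro!: derivative_eq_intros poly_DERIV[THEN DERIV_chain2]
          simp: flat_exp_def poly_monom power2_eq_square) (simp add: algebra_simps diff_divide_distrib)
    then show ?thesis
      by (rule has_field_derivative_transform_within_open[of _ _ _ "{0<..}"])
        (use 1 in \<open>auto simp: flat_exp_def\<close>)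
  next
    case 2
    have "((\<lambda>t. 0) has_real_derivative flat_exp (monom 1 2 * (p - pderiv p)) t) (at t)"
      using 2 by (auto simp: flat_exp_def)
    then show ?thesis
      by (rule has_field_derivative_transform_within_open[of _ _ _ "{..<0}"])
        (use 2 in \<open>auto simp: flat_exp_def\<close>)
  next
    case 3
    have "((\<lambda>h. poly (pCons 0 p) (inverse h) * exp (- inverse h)) \<longlongrightarrow> 0) (at_right 0)"
      by (rule filterlim_compose[OF tendsto_poly_times_exp_uminus_0 filterlim_inverse_at_top_right])
    then have "((\<lambda>h. flat_exp p h / h) \<longlongrightarrow> 0) (at_right 0)"
      by (rule Lim_transform_eventually)
        (auto simp: eventually_at_filter flat_exp_def field_simps)
    moreover have "((\<lambda>h. flat_exp p h / h) \<longlongrightarrow> 0) (at_left 0)"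
      by (rule Lim_transform_eventually[OF tendsto_const])
        (auto simp: eventually_at_filter flat_exp_def)
    ultimately have "((\<lambda>h. flat_exp p h / h) \<longlongrightarrow> 0) (at 0)"
      by (simp add: filterlim_split_at)
    then show ?thesis
      using 3 by (simp add: DERIV_def) (simp add: flat_exp_def)
  qed
qed

lemma partial_eqI: "(f has_derivative f') (at x) \<Longrightarrow> partial i f x = f' (axis i 1)"
  unfolding partial_def by (metis frechet_derivative_at)

lemma has_derivative_frechet_at:
  "f differentiable (at x) \<Longrightarrow> (f has_derivative frechet_derivative f (at x)) (at x)"
  by (simp add: frechet_derivative_works)

lemma C_k_const: "C_k k (\<lambda>x. c)"
proof (induction k arbitrary: c)
  case (Suc k)
  have "partial i (\<lambda>x. c) = (\<lambda>x. 0)" for i :: 'a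
    by (rule ext, subst partial_eqI[OF has_derivative_const]) simp
  then show ?case using Suc by simp
qed auto

lemma C_k_Suc_imp: "C_k (Suc k) f \<Longrightarrow> C_k k f"
proof (induction k arbitrary: f)
  case 0
  then show ?case
    by (auto intro!: continuous_at_imp_continuous_on differentiable_imp_continuous_within)
qed auto

lemma C_k_add:
  "C_k k f \<Longrightarrow> C_k k g \<Longrightarrow> C_k k (\<lambda>x. f x + g x)"
proof (induction k arbitrary: f g)
  case (Suc k)
  have "partial i (\<lambda>x. f x + g x) = (\<lambda>x. partial i f x + partial i g x)" for i
    using Suc.prems
    by (intro ext, subst partial_eqI[OF has_derivative_add[OF has_derivative_frechet_at has_derivative_frechet_at]])
      (simp_all add: partial_def)
  then show ?case using Suc by simp
qed (auto intro!: continuous_intros)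

lemma C_k_mult:
  "C_k k f \<Longrightarrow> C_k k g \<Longrightarrow> C_k k (\<lambda>x. f x * g x)"
proof (induction k arbitrary: f g)
  case (Suc k)
  have "partial i (\<lambda>x. f x * g x) = (\<lambda>x. f x * partial i g x + partial i f x * g x)" for i
    using Suc.prems
    by (intro ext, subst partial_eqI[OF has_derivative_mult[OF has_derivative_frechet_at has_derivative_frechet_at]])
      (simp_all add: partial_def)
  moreover have "C_k k f" "C_k k g"
    using Suc.prems C_k_Suc_imp by blast+
  ultimately show ?case using Suc by (auto intro!: C_k_add)
qed (auto intro!: continuous_intros)

lemma C_k_prod:
  "(\<And>i. i \<in> I \<Longrightarrow> C_k k (f i)) \<Longrightarrow> C_k k (\<lambda>x. \<Prod>i\<in>I. f i x)"
  by (induction I rule: infinite_finite_induct) (auto intro!: C_k_const C_k_mult)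

lemma partial_translate:
  assumes "f differentiable (at (x - y))"
  shows "partial i (\<lambda>x. f (x - y)) x = partial i f (x - y)"
proof -
  have "((\<lambda>x. f (x - y)) has_derivative frechet_derivative f (at (x - y))) (at x)"
    by (rule has_derivative_compose[where f = "\<lambda>x. x - y" and f' = "\<lambda>h. h"])
      (auto intro!: derivative_eq_intros has_derivative_frechet_at[OF assms])
  from partial_eqI[OF this] show ?thesis by (simp only: partial_def)
qed

lemma C_k_translate: "C_k k f \<Longrightarrow> C_k k (\<lambda>x. f (x - y))"
proof (induction k arbitrary: f)
  case 0
  then show ?case
    by (auto intro!: continuous_on_compose2[of UNIV f] continuous_intros)
next
  case (Suc k)
  have "(\<lambda>x. f (x - y)) differentiable (at x)" for x
    using Suc.prems by (intro differentiable_compose[of f "\<lambda>x. x - y"]) auto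
  moreover have "partial i (\<lambda>x. f (x - y)) = (\<lambda>x. partial i f (x - y))" for i
    using Suc.prems by (auto intro!: ext partial_translate)
  ultimately show ?case using Suc by auto
qed

text \<open>The affine argument \<open>a + s x\<^sub>i\<close> provides both factors needed to cut off a coordinate on two
  sides. Every partial derivative is a constant multiple of a function of the same form, which
  is why the induction has to run over all polynomials at once.\<close>

lemma C_k_flat_exp_coordinate:
  fixes i :: "'n::finite"
  shows "C_k k (\<lambda>x. flat_exp p (a + s * x $ i))"
proof (induction k arbitrary: p)
  case 0
  have "continuous_on UNIV (flat_exp p)"
    by (intro continuous_at_imp_continuous_on ballI DERIV_isCont[OF has_real_derivative_flat_exp])
  then show ?case
    by (auto intro!: continuous_on_compose2[of UNIV "flat_exp p"] continuous_intros)
next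
  case (Suc k)
  let ?q = "monom 1 2 * (p - pderiv p)"
  have d: "((\<lambda>x. flat_exp p (a + s * x $ i)) has_derivative
      (\<lambda>h. flat_exp ?q (a + s * x $ i) * (s * h $ i))) (at x)" for x :: "real^'n"
    by (rule has_derivative_compose[OF _ has_real_derivative_flat_exp[unfolded has_field_derivative_def]])
       (auto intro!: derivative_eq_intros bounded_linear_imp_has_derivative)
  have "partial j (\<lambda>x. flat_exp p (a + s * x $ i)) =
      (\<lambda>x. flat_exp ?q (a + s * x $ i) * (s * axis j 1 $ i))" for j
    using partial_eqI[OF d] by auto
  moreover have "(\<lambda>x. flat_exp p (a + s * x $ i)) differentiable (at x)" for x :: "real^'n"
    using d differentiable_def by blast
  ultimately show ?case using Suc by (auto intro!: C_k_mult C_k_const)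
qed

text \<open>The product over the coordinates of \<open>exp (-1/(s+x\<^sub>i)) exp (-1/(s-x\<^sub>i))\<close> is supported in the cube
  of half-width \<open>s\<close>; by the bound of the Euclidean norm by the \<open>l\<^sup>1\<close> norm, \<open>s = r/n\<close> places this
  cube in the ball of radius \<open>r\<close>.\<close>

lemma exists_smooth_bump:
  assumes "r > 0"
  obtains \<eta> :: "real^'n::finite \<Rightarrow> real"
  where "\<And>k. C_k k \<eta>" "\<And>x. 0 \<le> \<eta> x" "\<eta> 0 > 0" "\<And>x. \<eta> x \<noteq> 0 \<Longrightarrow> norm x < r"
proof
  define s where "s = r / CARD('n)"
  have s: "s > 0" using assms by (simp add: s_def)
  let ?\<eta> = "\<lambda>x::real^'n. \<Prod>i\<in>UNIV. flat_exp 1 (s + 1 * x $ i) * flat_exp 1 (s + (- 1) * x $ i)"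
  show "C_k k ?\<eta>" for k
    by (intro C_k_prod C_k_mult C_k_flat_exp_coordinate)
  show "0 \<le> ?\<eta> x" for x
    by (intro prod_nonneg) (auto simp: flat_exp_def)
  show "?\<eta> 0 > 0"
    using s by (intro prod_pos) (auto simp: flat_exp_def)
  show "norm x < r" if "?\<eta> x \<noteq> 0" for x
  proof -
    have "\<bar>x $ i\<bar> < s" for i
    proof -
      have "flat_exp 1 (s + 1 * x $ i) * flat_exp 1 (s + (- 1) * x $ i) \<noteq> 0"
        using that by (auto simp: prod_zero_iff)
      then show ?thesis by (auto simp: flat_exp_def split: if_splits)
    qed
    then have "(\<Sum>i\<in>UNIV. \<bar>x $ i\<bar>) < (\<Sum>i\<in>(UNIV::'n set). s)"
      by (intro sum_strict_mono) auto
    also have "\<dots> = r" by (simp add: s_def)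
    finally show ?thesis using norm_le_l1_cart[of x] by linarith
  qed
qed

section \<open>Second differences of smooth functions\<close>

lemma has_real_derivative_along_axis:
  fixes f :: "real^'n::finite \<Rightarrow> real"
  assumes "f differentiable (at (z + (\<sigma> * s) *\<^sub>R axis i 1))"
  shows "((\<lambda>s. f (z + (\<sigma> * s) *\<^sub>R axis i 1)) has_real_derivative
    \<sigma> * partial i f (z + (\<sigma> * s) *\<^sub>R axis i 1)) (at s)"
proof -
  let ?x = "z + (\<sigma> * s) *\<^sub>R axis i 1"
  have f': "(f has_derivative frechet_derivative f (at ?x)) (at ?x)"
    using assms by (rule has_derivative_frechet_at)
  have "((\<lambda>s. f (z + (\<sigma> * s) *\<^sub>R axis i 1)) has_derivative
      (\<lambda>h. frechet_derivative f (at ?x) ((\<sigma> * h) *\<^sub>R axis i 1))) (at s)"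
    by (rule has_derivative_compose[where g = f and f = "\<lambda>s. z + (\<sigma> * s) *\<^sub>R axis i 1" and
          f' = "\<lambda>h. (\<sigma> * h) *\<^sub>R axis i 1", OF _ f']) (auto intro!: derivative_eq_intros)
  moreover have "frechet_derivative f (at ?x) ((\<sigma> * h) *\<^sub>R axis i 1) = (\<sigma> * partial i f ?x) * h" for h
    using linear_scale[OF has_derivative_linear[OF f']] by (simp add: partial_def)
  ultimately show ?thesis
    by (simp add: has_field_derivative_def)
qed

text \<open>The sign \<open>\<sigma>\<close> covers the steps in both directions of the axis at once; in the second derivative
  it disappears.\<close>

lemma Taylor_along_axis:
  fixes f :: "real^'n::finite \<Rightarrow> real"
  assumes f: "C_k (Suc (Suc k)) f" and h: "0 < h" and \<sigma>: "\<sigma> * \<sigma> = 1"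
  obtains t where "0 < t" "t \<le> h"
    "f (z + (\<sigma> * h) *\<^sub>R axis i 1) =
      f z + \<sigma> * partial i f z * h + partial i (partial i f) (z + (\<sigma> * t) *\<^sub>R axis i 1) / 2 * h\<^sup>2"
proof -
  define D where "D m s = (if m = 0 then f (z + (\<sigma> * s) *\<^sub>R axis i 1)
    else if m = 1 then \<sigma> * partial i f (z + (\<sigma> * s) *\<^sub>R axis i 1)
    else partial i (partial i f) (z + (\<sigma> * s) *\<^sub>R axis i 1))" for m :: nat and s
  have "(D m has_real_derivative D (Suc m) t) (at t)" if "m < 2" for m t
  proof -
    consider "m = 0" | "m = 1" using \<open>m < 2\<close> by linarith
    then show ?thesis
    proof cases
      case 1
      then show ?thesis
        using has_real_derivative_along_axis[of f] f by (simp add: D_def[abs_def])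
    next
      case 2
      have "((\<lambda>s. \<sigma> * partial i f (z + (\<sigma> * s) *\<^sub>R axis i 1)) has_real_derivative
          \<sigma> * (\<sigma> * partial i (partial i f) (z + (\<sigma> * t) *\<^sub>R axis i 1))) (at t)"
        using f by (intro DERIV_cmult has_real_derivative_along_axis) simp
      then show ?thesis
        using 2 \<sigma> by (simp add: D_def[abs_def] mult.assoc[symmetric])
    qed
  qed
  then obtain t where "0 < t" "t \<le> h"
    "D 0 h = (\<Sum>m<2. D m 0 / fact m * h ^ m) + D 2 t / fact 2 * h ^ 2"
    using Maclaurin2[OF h, of D "D 0" 2] by auto
  then show ?thesis
    by (intro that[of t]) (simp_all add: D_def numeral_2_eq_2)
qed

text \<open>In the sum of the two Taylor expansions the first-order terms cancel, and only the oscillation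
  of the second derivative remains as an error.\<close>

lemma second_difference_approx:
  fixes f :: "real^'n::finite \<Rightarrow> real"
  assumes f: "C_k (Suc (Suc k)) f" and h: "0 < h"
    and osc: "\<And>s. \<bar>s\<bar> \<le> h \<Longrightarrow>
      \<bar>partial i (partial i f) (z + s *\<^sub>R axis i 1) - partial i (partial i f) z\<bar> \<le> e"
  shows "\<bar>f (z + h *\<^sub>R axis i 1) + f (z - h *\<^sub>R axis i 1) - 2 * f z
      - h\<^sup>2 * partial i (partial i f) z\<bar> \<le> e * h\<^sup>2"
proof -
  let ?F = "partial i (partial i f)"
  obtain t where t: "0 < t" "t \<le> h" "f (z + (1 * h) *\<^sub>R axis i 1) =
      f z + 1 * partial i f z * h + ?F (z + (1 * t) *\<^sub>R axis i 1) / 2 * h\<^sup>2"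
    using Taylor_along_axis[OF f h, of 1 z i] by auto
  obtain u where u: "0 < u" "u \<le> h" "f (z + (- 1 * h) *\<^sub>R axis i 1) =
      f z + - 1 * partial i f z * h + ?F (z + (- 1 * u) *\<^sub>R axis i 1) / 2 * h\<^sup>2"
    using Taylor_along_axis[OF f h, of "- 1" z i] by auto
  let ?a = "?F (z + t *\<^sub>R axis i 1) - ?F z" and ?b = "?F (z + (- u) *\<^sub>R axis i 1) - ?F z"
  have "f (z + h *\<^sub>R axis i 1) + f (z - h *\<^sub>R axis i 1) - 2 * f z - h\<^sup>2 * ?F z = (?a + ?b) / 2 * h\<^sup>2"
    using t(3) u(3) by (simp add: field_simps)
  moreover have "\<bar>?a\<bar> \<le> e" "\<bar>?b\<bar> \<le> e"
    using t u by (auto intro!: osc simp del: scaleR_minus_left)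
  then have "\<bar>(?a + ?b) / 2\<bar> * h\<^sup>2 \<le> e * h\<^sup>2"
    by (intro mult_right_mono) auto
  ultimately show ?thesis by (simp only: abs_mult abs_power2)
qed

lemma C_k_imp_continuous: "C_k k f \<Longrightarrow> continuous_on UNIV f"
  by (induction k) (use C_k_Suc_imp in auto)

lemma continuous_laplacian:
  "C_k (Suc (Suc k)) f \<Longrightarrow> continuous_on UNIV (laplacian f)"
  unfolding laplacian_def[abs_def] by (intro continuous_on_sum C_k_imp_continuous[of k]) simp

lemma laplacian_translate:
  assumes "C_k (Suc (Suc k)) f"
  shows "laplacian (\<lambda>x. f (x - y)) x = laplacian f (x - y)"
proof -
  have "partial i (\<lambda>x. f (x - y)) = (\<lambda>x. partial i f (x - y))" for i
    using assms by (intro ext partial_translate) simp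
  moreover have "partial i (\<lambda>x. partial i f (x - y)) x = partial i (partial i f) (x - y)" for i
    using assms by (intro partial_translate) simp
  ultimately show ?thesis unfolding laplacian_def by simp
qed

lemma translate_in_test_functions:
  assumes "\<And>k. C_k k \<eta>" and "\<And>x. \<eta> x \<noteq> 0 \<Longrightarrow> norm x < r" and "cball y r \<subseteq> E"
  shows "(\<lambda>x. \<eta> (x - y)) \<in> test_functions E"
proof -
  have "{x. \<eta> (x - y) \<noteq> 0} \<subseteq> cball y r"
    using assms(2) by (force simp: dist_norm norm_minus_commute)
  then have "closure {x. \<eta> (x - y) \<noteq> 0} \<subseteq> cball y r"
    by (simp add: closure_minimal)
  then have "closure {x. \<eta> (x - y) \<noteq> 0} \<subseteq> E" "bounded (closure {x. \<eta> (x - y) \<noteq> 0})"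
    using assms(3) bounded_subset bounded_cball by blast+
  then show ?thesis
    unfolding test_functions_def using C_k_translate[OF assms(1)] by (simp add: compact_eq_bounded_closed)
qed

lemma set_integrable_continuous_closure:
  fixes f :: "'a::euclidean_space \<Rightarrow> real"
  assumes "open E" "bounded E" "continuous_on (closure E) f"
  shows "set_integrable lebesgue E f"
proof -
  have "set_integrable lborel (closure E) f"
    unfolding set_integrable_def using assms by (intro borel_integrable_compact) auto
  then have "set_integrable lborel E f"
    by (rule set_integrable_subset) (use assms closure_subset in auto)
  then show ?thesis
    unfolding set_integrable_def by (simp add: integrable_completion)
qed

lemma abs_set_integral_le:
  fixes f :: "'a::euclidean_space \<Rightarrow> real"
  assumes "E \<in> lmeasurable" "set_integrable lebesgue E f" "\<And>x. x \<in> E \<Longrightarrow> \<bar>f x\<bar> \<le> B"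
  shows "\<bar>LINT x:E|lebesgue. f x\<bar> \<le> B * measure lebesgue E"
proof -
  have "\<bar>LINT x:E|lebesgue. f x\<bar> \<le> (LINT x:E|lebesgue. \<bar>f x\<bar>)"
    using set_integral_norm_bound[OF assms(2)] by simp
  also have "\<dots> \<le> (LINT x:E|lebesgue. B)"
    using assms by (intro set_integral_mono set_integrable_abs)
      (auto simp: set_integrable_def fmeasurable_def)
  also have "\<dots> = B * measure lebesgue E"
    using assms(1) by (simp add: set_lebesgue_integral_def)
  finally show ?thesis .
qed

text \<open>Uniform continuity on a ball that contains all the points involved, of which there is one
  because \<open>E\<close> is bounded.\<close>

lemma equicontinuous_translates:
  fixes f :: "'a::euclidean_space \<Rightarrow> real"
  assumes "continuous_on UNIV f" "bounded E" "0 < e"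
  obtains d where "0 < d" "\<And>x z. x \<in> E \<Longrightarrow> norm z < d \<Longrightarrow> \<bar>f (x - y + z) - f (x - y)\<bar> < e"
proof -
  obtain R where R: "\<And>x. x \<in> E \<Longrightarrow> norm x \<le> R"
    using assms(2) by (auto simp: bounded_iff)
  let ?C = "cball 0 (R + norm y + 1) :: 'a set"
  have "uniformly_continuous_on ?C f"
    using assms(1) by (intro compact_uniformly_continuous) (auto intro: continuous_on_subset)
  then obtain d where d: "0 < d"
      "\<And>x x'. x \<in> ?C \<Longrightarrow> x' \<in> ?C \<Longrightarrow> dist x' x < d \<Longrightarrow> dist (f x') (f x) < e"
    using assms(3) unfolding uniformly_continuous_on_def by meson
  show ?thesis
  proof (rule that[of "min d 1"])
    fix x z :: 'a assume "x \<in> E" and z: "norm z < min d 1"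
    then have "norm (x - y) \<le> R + norm y"
      using R[of x] norm_triangle_ineq4[of x y] by simp
    moreover have "norm (x - y + z) \<le> norm (x - y) + norm z"
      by (rule norm_triangle_ineq)
    ultimately have "x - y \<in> ?C" "x - y + z \<in> ?C"
      using z by (simp_all only: mem_cball_0)
    moreover have "dist (x - y + z) (x - y) < d"
      using z by (simp add: dist_norm)
    ultimately have "dist (f (x - y + z)) (f (x - y)) < e"
      by (rule d(2))
    then show "\<bar>f (x - y + z) - f (x - y)\<bar> < e" by (simp add: dist_real_def)
  qed (use d in auto)
qed

section \<open>Mollification of continuous functions\<close>

text \<open>The convolution of \<open>v\<close>, restricted to \<open>E\<close>, with the reflected kernel \<open>\<eta>(-x)\<close>. Written this way, the
  kernel at \<open>y\<close> is a translate of \<open>\<eta>\<close> and can be inserted as a test function.\<close>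

definition mollify ::
  "(real^'n::finite) set \<Rightarrow> (real^'n \<Rightarrow> real) \<Rightarrow> (real^'n \<Rightarrow> real) \<Rightarrow> real^'n \<Rightarrow> real" where
  "mollify E \<eta> v y = (LINT x:E|lebesgue. v x * \<eta> (x - y))"

lemma bounded_on_closure:
  fixes v :: "'a::euclidean_space \<Rightarrow> real"
  assumes "bounded E" "continuous_on (closure E) v"
  obtains M where "0 < M" "\<And>x. x \<in> E \<Longrightarrow> \<bar>v x\<bar> \<le> M"
proof -
  have "bounded (v ` closure E)"
    using assms by (simp add: compact_continuous_image compact_imp_bounded)
  then obtain M where "0 < M" "\<And>x. x \<in> closure E \<Longrightarrow> \<bar>v x\<bar> \<le> M"
    by (auto simp: bounded_pos)
  then show ?thesis using that closure_subset by blast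
qed

lemma set_integrable_mollify:
  fixes v \<eta> :: "'a::euclidean_space \<Rightarrow> real"
  assumes "open E" "bounded E" "continuous_on (closure E) v" "continuous_on UNIV \<eta>"
  shows "set_integrable lebesgue E (\<lambda>x. v x * \<eta> (x - y))"
proof (rule set_integrable_continuous_closure[OF assms(1,2)])
  have "continuous_on (closure E) (\<lambda>x. \<eta> (x - y))"
    by (rule continuous_on_compose2[OF assms(4)]) (auto intro: continuous_intros)
  then show "continuous_on (closure E) (\<lambda>x. v x * \<eta> (x - y))"
    using assms(3) by (intro continuous_on_mult)
qed

lemma continuous_mollify:
  assumes E: "open E" "bounded E" and v: "continuous_on (closure E) v" and \<eta>: "continuous_on UNIV \<eta>"
  shows "continuous_on UNIV (mollify E \<eta> v)"
proof (rule continuous_at_imp_continuous_on, rule ballI)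
  fix y
  obtain M where M: "0 < M" "\<And>x. x \<in> E \<Longrightarrow> \<bar>v x\<bar> \<le> M"
    using bounded_on_closure[OF E(2) v] by blast
  have Em: "E \<in> lmeasurable" using E by (simp add: lmeasurable_open)
  let ?L = "measure lebesgue E"
  note int = set_integrable_mollify[OF E v \<eta>]
  show "isCont (mollify E \<eta> v) y"
    unfolding continuous_at_eps_delta dist_norm
  proof (intro allI impI)
    fix e :: real assume "0 < e"
    define e' where "e' = e / (2 * M * (?L + 1))"
    have e': "0 < e'" using \<open>0 < e\<close> M by (simp add: e'_def add_nonneg_pos)
    obtain d where d: "0 < d"
        "\<And>x z. x \<in> E \<Longrightarrow> norm z < d \<Longrightarrow> \<bar>\<eta> (x - y + z) - \<eta> (x - y)\<bar> < e'"
      using equicontinuous_translates[OF \<eta> E(2) e'] by blast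
    show "\<exists>d>0. \<forall>y'. norm (y' - y) < d \<longrightarrow> norm (mollify E \<eta> v y' - mollify E \<eta> v y) < e"
    proof (intro exI conjI allI impI)
      fix y' assume y': "norm (y' - y) < d"
      have "mollify E \<eta> v y' - mollify E \<eta> v y =
          (LINT x:E|lebesgue. v x * \<eta> (x - y') - v x * \<eta> (x - y))"
        unfolding mollify_def using int by (simp add: set_integral_diff)
      moreover have "\<bar>LINT x:E|lebesgue. v x * \<eta> (x - y') - v x * \<eta> (x - y)\<bar> \<le> (M * e') * ?L"
      proof (intro abs_set_integral_le Em set_integral_diff int)
        fix x assume x: "x \<in> E"
        have "\<bar>\<eta> (x - y') - \<eta> (x - y)\<bar> \<le> e'"
          using d(2)[OF x, of "y - y'"] y' by (simp add: norm_minus_commute)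
        then have "\<bar>v x\<bar> * \<bar>\<eta> (x - y') - \<eta> (x - y)\<bar> \<le> M * e'"
          using M x by (intro mult_mono) auto
        then show "\<bar>v x * \<eta> (x - y') - v x * \<eta> (x - y)\<bar> \<le> M * e'"
          by (simp add: right_diff_distrib[symmetric] abs_mult)
      qed
      moreover have "(M * e') * ?L < e"
      proof -
        have "(M * e') * (?L + 1) = e / 2"
          using M add_nonneg_pos[OF measure_nonneg[of lebesgue E] zero_less_one] unfolding e'_def
          by (simp add: divide_simps)
        then show ?thesis using \<open>0 < e\<close> mult_pos_pos[OF M(1) e'] by (simp add: algebra_simps)
      qed
      ultimately show "norm (mollify E \<eta> v y' - mollify E \<eta> v y) < e" by simp
    qed (use d in simp)
  qed
qed

text \<open>Second differences pass from \<open>V = mollify E \<eta> v\<close> to the kernel, where the sum over the axes is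
  \<open>h\<^sup>2 \<Delta>\<eta>(x-y)\<close> up to an error small against \<open>h\<^sup>2\<close>, uniformly in \<open>x\<close>. The integral of \<open>v\<close>
  against the main term vanishes, since the translated kernel is a test function and \<open>v\<close> is
  harmonic. This takes the place of the equation \<open>\<Delta>V = 0\<close> and avoids differentiation under the
  integral.\<close>

lemma mollify_second_differences:
  fixes E :: "(real^'n::finite) set"
  assumes E: "open E" "bounded E" and v: "continuous_on (closure E) v" "harmonic_in v E"
    and \<eta>: "\<And>k. C_k k \<eta>" "\<And>x. \<eta> x \<noteq> 0 \<Longrightarrow> norm x < r" "cball y r \<subseteq> E"
    and "0 < \<kappa>"
  shows "\<forall>\<^sub>F h in at_right 0. (\<Sum>i\<in>UNIV. mollify E \<eta> v (y + h *\<^sub>R axis i 1)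
      + mollify E \<eta> v (y - h *\<^sub>R axis i 1) - 2 * mollify E \<eta> v y) \<le> \<kappa> * h\<^sup>2"
proof -
  let ?V = "mollify E \<eta> v" and ?L = "measure lebesgue E" and ?e = "\<lambda>i::'n. axis i (1::real)"
  let ?F = "\<lambda>i. partial i (partial i \<eta>)"
  obtain M where M: "0 < M" "\<And>x. x \<in> E \<Longrightarrow> \<bar>v x\<bar> \<le> M"
    using bounded_on_closure[OF E(2) v(1)] by blast
  have Em: "E \<in> lmeasurable" using E by (simp add: lmeasurable_open)
  have C2: "C_k (Suc (Suc k)) \<eta>" for k by (rule \<eta>(1))
  have cont: "continuous_on UNIV \<eta>" "continuous_on UNIV (laplacian \<eta>)"
    using \<eta>(1) C_k_imp_continuous continuous_laplacian by blast+
  note int = set_integrable_mollify[OF E v(1) cont(1)] set_integrable_mollify[OF E v(1) cont(2)]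
  \<comment> \<open>With \<open>|v| \<le> M\<close> and one error \<open>e h\<^sup>2\<close> for each axis, integration over \<open>E\<close> gives at most
      \<open>\<kappa> h\<^sup>2\<close>. The summand \<open>1\<close> keeps the denominator positive for empty \<open>E\<close>.\<close>
  define e where "e = \<kappa> / (M * CARD('n) * (?L + 1))"
  have e: "0 < e" using \<open>0 < \<kappa>\<close> M by (simp add: e_def add_nonneg_pos)
  have "\<exists>d>0. \<forall>x\<in>E. \<forall>z. norm z < d \<longrightarrow> \<bar>?F i (x - y + z) - ?F i (x - y)\<bar> < e" for i
  proof -
    have "continuous_on UNIV (?F i)" using C2[of 0] by simp
    from equicontinuous_translates[OF this E(2) e, of y] show ?thesis by metis
  qed
  then obtain d where d: "\<And>i. 0 < d i"
      "\<And>i x z. x \<in> E \<Longrightarrow> norm z < d i \<Longrightarrow> \<bar>?F i (x - y + z) - ?F i (x - y)\<bar> < e"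
    by metis
  have harm: "(LINT x:E|lebesgue. v x * laplacian \<eta> (x - y)) = 0"
    using v(2) translate_in_test_functions[OF \<eta>] laplacian_translate[OF C2]
    unfolding harmonic_in_def by fastforce
  have main: "(\<Sum>i\<in>UNIV. ?V (y + h *\<^sub>R ?e i) + ?V (y - h *\<^sub>R ?e i) - 2 * ?V y) \<le> \<kappa> * h\<^sup>2"
    if h: "0 < h" "\<And>i. h < d i" for h
  proof -
    define D where "D i x = \<eta> (x - (y + h *\<^sub>R ?e i)) + \<eta> (x - (y - h *\<^sub>R ?e i)) - 2 * \<eta> (x - y)" for i x
    have intD: "set_integrable lebesgue E (\<lambda>x. v x * D i x)" for i
      unfolding D_def distrib_left right_diff_distrib mult.left_commute[of _ 2]
      by (intro set_integral_add set_integral_diff set_integrable_mult_right int)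
    have VD: "?V (y + h *\<^sub>R ?e i) + ?V (y - h *\<^sub>R ?e i) - 2 * ?V y = (LINT x:E|lebesgue. v x * D i x)" for i
      unfolding D_def distrib_left right_diff_distrib mult.left_commute[of _ 2] mollify_def
      by (simp add: set_integral_add set_integral_diff int)
    have sum: "(\<lambda>x. v x * (\<Sum>i\<in>UNIV. D i x)) = (\<lambda>x. \<Sum>i\<in>UNIV. v x * D i x)"
      by (simp add: sum_distrib_left)
    have intS: "set_integrable lebesgue E (\<lambda>x. v x * (\<Sum>i\<in>UNIV. D i x))"
      unfolding sum set_integrable_def scaleR_sum_right
      by (intro Bochner_Integration.integrable_sum intD[unfolded set_integrable_def])
    have "(\<Sum>i\<in>UNIV. ?V (y + h *\<^sub>R ?e i) + ?V (y - h *\<^sub>R ?e i) - 2 * ?V y)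
        = (LINT x:E|lebesgue. v x * (\<Sum>i\<in>UNIV. D i x))"
      unfolding VD sum set_lebesgue_integral_def scaleR_sum_right
      by (intro Bochner_Integration.integral_sum[symmetric] intD[unfolded set_integrable_def])
    also have "\<dots> = (LINT x:E|lebesgue. v x * (\<Sum>i\<in>UNIV. D i x) - h\<^sup>2 * (v x * laplacian \<eta> (x - y)))"
      using intS int by (simp add: set_integral_diff harm)
    also have "\<dots> \<le> (M * (CARD('n) * (e * h\<^sup>2))) * ?L"
    proof (rule order_trans[OF abs_ge_self], rule abs_set_integral_le[OF Em])
      show "set_integrable lebesgue E
          (\<lambda>x. v x * (\<Sum>i\<in>UNIV. D i x) - h\<^sup>2 * (v x * laplacian \<eta> (x - y)))"
        by (intro set_integral_diff intS set_integrable_mult_right int)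
      fix x assume x: "x \<in> E"
      have "\<bar>D i x - h\<^sup>2 * ?F i (x - y)\<bar> \<le> e * h\<^sup>2" for i
      proof -
        have "\<bar>\<eta> (x - y + h *\<^sub>R ?e i) + \<eta> (x - y - h *\<^sub>R ?e i) - 2 * \<eta> (x - y)
            - h\<^sup>2 * ?F i (x - y)\<bar> \<le> e * h\<^sup>2"
        proof (rule second_difference_approx[OF C2 h(1)])
          fix s assume "\<bar>s\<bar> \<le> h"
          then have "norm (s *\<^sub>R ?e i) < d i" using h(2)[of i] by simp
          then show "\<bar>?F i (x - y + s *\<^sub>R ?e i) - ?F i (x - y)\<bar> \<le> e"
            using d(2)[OF x] by (meson less_imp_le)
        qed
        then show ?thesis by (simp add: D_def algebra_simps)
      qed
      then have "\<bar>\<Sum>i\<in>UNIV. D i x - h\<^sup>2 * ?F i (x - y)\<bar> \<le> (\<Sum>i\<in>(UNIV::'n set). e * h\<^sup>2)"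
        by (intro order_trans[OF sum_abs] sum_mono)
      then have "\<bar>v x\<bar> * \<bar>\<Sum>i\<in>UNIV. D i x - h\<^sup>2 * ?F i (x - y)\<bar> \<le> M * (CARD('n) * (e * h\<^sup>2))"
        using M x by (intro mult_mono) auto
      moreover have "v x * (\<Sum>i\<in>UNIV. D i x) - h\<^sup>2 * (v x * laplacian \<eta> (x - y))
          = v x * (\<Sum>i\<in>UNIV. D i x - h\<^sup>2 * ?F i (x - y))"
        by (simp add: laplacian_def sum_subtractf sum_distrib_left[symmetric] algebra_simps)
      ultimately show "\<bar>v x * (\<Sum>i\<in>UNIV. D i x) - h\<^sup>2 * (v x * laplacian \<eta> (x - y))\<bar>
          \<le> M * (CARD('n) * (e * h\<^sup>2))"
        by (simp add: abs_mult)
    qed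
    also have "\<dots> \<le> (M * (CARD('n) * (e * h\<^sup>2))) * (?L + 1)"
      using M e by (intro mult_left_mono) auto
    also have "\<dots> = \<kappa> * h\<^sup>2"
    proof -
      have "0 < ?L + 1" by (simp add: add_nonneg_pos)
      then show ?thesis using M unfolding e_def by (simp add: divide_simps)
    qed
    finally show ?thesis .
  qed
  have "\<forall>\<^sub>F h in at_right 0. \<forall>i\<in>UNIV. h < d i"
    by (rule eventually_ball_finite) (auto simp: d eventually_at_right_less intro: order_tendstoD(2)[OF tendsto_ident_at])
  then show ?thesis
    using eventually_at_right_less[of 0] by eventually_elim (auto intro: main)
qed

text \<open>The mass of the kernel is independent of its centre, as long as its support stays in \<open>E\<close>.
  Hence mollification reproduces constants up to one common factor, see
  \<open>mollify_const\<close> below.\<close>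

lemma integral_bump_translate:
  fixes \<eta> :: "real^'n::finite \<Rightarrow> real"
  assumes \<eta>: "continuous_on UNIV \<eta>" "\<And>x. \<eta> x \<noteq> 0 \<Longrightarrow> norm x < r" "cball y r \<subseteq> E"
  shows "(LINT x:E|lebesgue. \<eta> (x - y)) = (LINT x|lebesgue. \<eta> x)"
proof -
  have "indicator E x * \<eta> (x - y) = \<eta> (x - y)" for x
  proof (cases "\<eta> (x - y) = 0")
    case False
    then have "x \<in> cball y r"
      using \<eta>(2)[of "x - y"] by (simp add: dist_norm norm_minus_commute)
    then show ?thesis using \<eta>(3) by auto
  qed simp
  then have "(LINT x:E|lebesgue. \<eta> (x - y)) = (LINT x|lebesgue. \<eta> (x - y))"
    unfolding set_lebesgue_integral_def real_scaleR_def by presburger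
  also have "\<dots> = (LINT x|lborel. \<eta> (x - y))"
    using \<eta>(1) by (intro integral_completion)
      (auto intro!: borel_measurable_continuous_onI continuous_on_compose2[of UNIV \<eta>] continuous_intros)
  also have "\<dots> = (LINT x|distr lborel borel ((+) (- y)). \<eta> x)"
    using \<eta>(1) by (subst integral_distr) (auto intro!: borel_measurable_continuous_onI)
  also have "\<dots> = (LINT x|lborel. \<eta> x)"
    by (simp add: lborel_distr_plus)
  also have "\<dots> = (LINT x|lebesgue. \<eta> x)"
    using \<eta>(1) by (intro integral_completion[symmetric]) (auto intro!: borel_measurable_continuous_onI)
  finally show ?thesis .
qed

text \<open>A nonnegative function with integral \<open>0\<close> vanishes almost everywhere, but the set where the
  continuous function \<open>\<eta>\<close> is nonzero is open and contains \<open>0\<close>.\<close>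

lemma integral_bump_pos:
  fixes \<eta> :: "'a::euclidean_space \<Rightarrow> real"
  assumes \<eta>: "continuous_on UNIV \<eta>" "\<And>x. \<eta> x \<noteq> 0 \<Longrightarrow> norm x < r" "\<And>x. 0 \<le> \<eta> x" "0 < \<eta> 0"
  shows "0 < (LINT x|lebesgue. \<eta> x)"
proof -
  have "set_integrable lebesgue (ball 0 r) \<eta>"
    using \<eta>(1) by (intro set_integrable_continuous_closure) (auto intro: continuous_on_subset)
  moreover have "(\<lambda>x. indicator (ball 0 r) x *\<^sub>R \<eta> x) = \<eta>"
    using \<eta>(2) by (auto simp: indicator_def fun_eq_iff)
  ultimately have int: "integrable lebesgue \<eta>"
    by (simp add: set_integrable_def)
  have "\<not> (AE x in lebesgue. \<eta> x = 0)"
  proof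
    assume "AE x in lebesgue. \<eta> x = 0"
    then have "negligible {x. \<eta> x \<noteq> 0}"
      by (simp add: negligible_iff_null_sets eventually_ae_filter) (metis (lifting) completion.complete2 space_completion mem_Collect_eq)
    moreover have "open {x. \<eta> x \<noteq> 0}"
      using \<eta>(1) by (intro open_Collect_neq) auto
    ultimately show False
      using open_not_negligible \<eta>(4) by fastforce
  qed
  then have "(LINT x|lebesgue. \<eta> x) \<noteq> 0"
    using integral_nonneg_eq_0_iff_AE[OF int] \<eta>(3) by auto
  moreover have "0 \<le> (LINT x|lebesgue. \<eta> x)"
    using \<eta>(3) by (simp add: integral_nonneg_AE)
  ultimately show ?thesis by simp
qed

lemma mollify_mono:
  assumes E: "open E" "bounded E" and v: "continuous_on (closure E) v" "continuous_on (closure E) w"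
    and \<eta>: "continuous_on UNIV \<eta>" "\<And>x. 0 \<le> \<eta> x"
    and le: "\<And>x. x \<in> E \<Longrightarrow> \<eta> (x - y) \<noteq> 0 \<Longrightarrow> v x \<le> w x"
  shows "mollify E \<eta> v y \<le> mollify E \<eta> w y"
  unfolding mollify_def
proof (rule set_integral_mono)
  fix x assume "x \<in> E"
  then show "v x * \<eta> (x - y) \<le> w x * \<eta> (x - y)"
    using le \<eta>(2)[of "x - y"] by (cases "\<eta> (x - y) = 0") (auto intro: mult_right_mono)
qed (use set_integrable_mollify assms in blast)+

lemma mollify_const:
  assumes "continuous_on UNIV \<eta>" "\<And>x. \<eta> x \<noteq> 0 \<Longrightarrow> norm x < r" "cball y r \<subseteq> E"
  shows "mollify E \<eta> (\<lambda>x. c) y = c * (LINT x|lebesgue. \<eta> x)"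
  unfolding mollify_def using integral_bump_translate[OF assms] by simp

section \<open>The weak minimum principle\<close>

lemma frontier_point_within:
  fixes y :: "'a::euclidean_space"
  assumes "y \<in> E" "w \<notin> E"
  obtains f where "f \<in> frontier E" "dist y f \<le> dist y w"
proof -
  have "closed_segment y w \<inter> frontier E \<noteq> {}"
    using assms by (intro connected_Int_frontier) auto
  then obtain f where "f \<in> frontier E" "f \<in> closed_segment y w" by blast
  then show ?thesis using that dist_in_closed_segment by (metis dist_commute)
qed

text \<open>Suppose \<open>v x0 = -m < 0\<close>. By uniform continuity \<open>v\<close> is at least \<open>-m/4\<close> in a boundary layer, so for
  a kernel of small support the mollification \<open>V\<close> is at least \<open>-m/4\<close> (times the mass \<open>I\<close> of the
  kernel) at the points of the inner set \<open>K\<close> that are nearest to the complement of \<open>E\<close>, and at most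
  \<open>-3m/4\<close> (times \<open>I\<close>) at \<open>x0 \<in> K\<close>. The gap leaves room for a perturbation \<open>F y = V y - \<epsilon> |y|\<^sup>2\<close> whose
  minimum over \<open>K\<close> is still attained in the interior of \<open>K\<close>. At such a point the second differences
  of \<open>F\<close> are nonnegative, so those of \<open>V\<close> are at least \<open>2\<epsilon>h\<^sup>2\<close> in each direction, although their
  sum is at most \<open>\<epsilon>h\<^sup>2\<close> for small \<open>h\<close>.\<close>

theorem weak_minimum_principle:
  fixes E :: "(real^'n::finite) set"
  assumes E: "open E" "bounded E"
    and v: "continuous_on (closure E) v" "harmonic_in v E"
    and bdry: "\<And>x. x \<in> frontier E \<Longrightarrow> 0 \<le> v x"
    and x0: "x0 \<in> E"
  shows "0 \<le> v x0"
proof (rule ccontr)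
  assume "\<not> 0 \<le> v x0"
  define m where "m = - v x0"
  have m: "0 < m" using \<open>\<not> 0 \<le> v x0\<close> by (simp add: m_def)
  have "uniformly_continuous_on (closure E) v"
    using E v by (intro compact_uniformly_continuous) auto
  moreover have "0 < m / 4" using m by simp
  ultimately obtain d where d: "0 < d"
      "\<And>x x'. x \<in> closure E \<Longrightarrow> x' \<in> closure E \<Longrightarrow> dist x' x < d \<Longrightarrow> dist (v x') (v x) < m / 4"
    by (rule uniformly_continuous_onE) blast
  have near_bdry: "- (m / 4) \<le> v x" if "x \<in> E" "f \<in> frontier E" "dist x f < d" for x f
  proof -
    have "x \<in> closure E" "f \<in> closure E"
      using that closure_subset by (auto simp: frontier_def)
    then show ?thesis using d(2)[of f x] bdry[OF that(2)] that(3) by (simp add: dist_real_def dist_commute abs_if split: if_splits)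
  qed
  \<comment> \<open>A point of the kernel centred at distance \<open>r\<close> from the boundary is less than
      \<open>r + r/2 < d\<close> away from a boundary point.\<close>
  define r where "r = d / 4"
  have r: "0 < r" using d by (simp add: r_def)
  obtain \<eta> :: "real^'n \<Rightarrow> real" where \<eta>: "\<And>k. C_k k \<eta>" "\<And>x. 0 \<le> \<eta> x" "\<eta> 0 > 0"
      "\<And>x. \<eta> x \<noteq> 0 \<Longrightarrow> norm x < r / 2"
    using exists_smooth_bump[OF half_gt_zero[OF r]] by blast
  have c\<eta>: "continuous_on UNIV \<eta>" using \<eta>(1) C_k_imp_continuous by blast
  define I where "I = (LINT x|lebesgue. \<eta> x)"
  have I: "0 < I" unfolding I_def using integral_bump_pos[OF c\<eta> \<eta>(4) \<eta>(2) \<eta>(3)] .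
  define K where "K = {y \<in> closure E. r \<le> infdist y (- E)}"
  have "E \<noteq> UNIV" using E(2) not_bounded_UNIV by blast
  then have compl: "closed (- E)" "- E \<noteq> {}"
    using E(1) by (blast intro: closed_Compl)+
  have attain: "\<exists>w. w \<notin> E \<and> infdist y (- E) = dist y w" for y
    using infdist_attains_inf[OF compl] by blast
  have K_I: "y \<in> K" if "r \<le> infdist y (- E)" for y
  proof -
    have "y \<notin> - E"
    proof
      assume "y \<in> - E"
      then show False using infdist_zero[of y "- E"] that r by linarith
    qed
    then show ?thesis using that closure_subset[of E] by (auto simp: K_def)
  qed
  have K_cball: "cball y (r / 2) \<subseteq> E" if "y \<in> K" for y
  proof
    fix x assume "x \<in> cball y (r / 2)"
    then have "dist y x < infdist y (- E)" using that r by (simp add: K_def)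
    then show "x \<in> E" using infdist_le[of x "- E" y] by auto
  qed
  have K_E: "y \<in> E" if "y \<in> K" for y
    using K_cball[OF that] r by auto
  have "compact K"
  proof -
    have "closed {y. r \<le> infdist y (- E)}"
      by (intro closed_Collect_le continuous_intros)
    moreover have "K = closure E \<inter> {y. r \<le> infdist y (- E)}" by (auto simp: K_def)
    ultimately show ?thesis using E by (simp add: compact_Int_closed)
  qed
  have x0K: "x0 \<in> K"
  proof (rule K_I, rule ccontr)
    assume "\<not> r \<le> infdist x0 (- E)"
    then obtain w where "w \<notin> E" "dist x0 w < r" using attain[of x0] by auto
    moreover obtain f where "f \<in> frontier E" "dist x0 f \<le> dist x0 w"
      using frontier_point_within[OF x0 \<open>w \<notin> E\<close>] .
    ultimately have "- (m / 4) \<le> v x0" using r by (intro near_bdry[OF x0]) (auto simp: r_def)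
    then show False using m by (simp add: m_def)
  qed
  define V where "V = mollify E \<eta> v"
  obtain B where B: "\<And>x. x \<in> E \<Longrightarrow> norm x \<le> B"
    using E(2) by (auto simp: bounded_iff)
  \<comment> \<open>Over \<open>E\<close> the perturbation uses at most half of the gap \<open>m I / 2\<close>.\<close>
  define \<epsilon> where "\<epsilon> = m * I / 4 / (B\<^sup>2 + 1)"
  have \<epsilon>: "0 < \<epsilon>" "\<epsilon> * B\<^sup>2 \<le> m * I / 4"
  proof -
    have "0 < B\<^sup>2 + 1" by (simp add: add_nonneg_pos)
    then show "0 < \<epsilon>" using m I by (simp add: \<epsilon>_def)
    then have "\<epsilon> * B\<^sup>2 \<le> \<epsilon> * (B\<^sup>2 + 1)" by simp
    also have "\<dots> = m * I / 4"
      unfolding \<epsilon>_def using \<open>0 < B\<^sup>2 + 1\<close> by (intro nonzero_eq_divide_eq[THEN iffD1, OF _ refl]) simp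
    finally show "\<epsilon> * B\<^sup>2 \<le> m * I / 4" .
  qed
  have "continuous_on K (\<lambda>y. V y - \<epsilon> * (norm y)\<^sup>2)"
    unfolding V_def
    by (intro continuous_intros continuous_on_subset[OF continuous_mollify[OF E v(1) c\<eta>]]) auto
  then obtain y where y: "y \<in> K" "\<And>z. z \<in> K \<Longrightarrow> V y - \<epsilon> * (norm y)\<^sup>2 \<le> V z - \<epsilon> * (norm z)\<^sup>2"
    using continuous_attains_inf[OF \<open>compact K\<close>] x0K by blast
  show False
  \<comment> \<open>In the first case \<open>V y\<close> is too large for \<open>y\<close> to be a minimum; in the second all small axis-parallel steps from \<open>y\<close> stay in \<open>K\<close>.\<close>
  proof (cases "infdist y (- E) = r")
    case True
    obtain w where "w \<notin> E" "dist y w = r" using attain[of y] True by auto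
    then obtain f where f: "f \<in> frontier E" "dist y f \<le> r"
      using frontier_point_within[OF K_E[OF y(1)] \<open>w \<notin> E\<close>] by auto
    have "mollify E \<eta> (\<lambda>x. - (m / 4)) y \<le> V y"
      unfolding V_def
    proof (rule mollify_mono[OF E _ v(1) c\<eta> \<eta>(2)])
      fix x assume "x \<in> E" "\<eta> (x - y) \<noteq> 0"
      then have "dist x y < r / 2" using \<eta>(4) by (simp add: dist_norm)
      then have "dist x f < d" using f(2) r dist_triangle[of x f y] by (simp add: r_def)
      then show "- (m / 4) \<le> v x" using near_bdry[OF \<open>x \<in> E\<close> f(1)] by simp
    qed simp
    moreover have "V x0 \<le> mollify E \<eta> (\<lambda>x. - (3 * m / 4)) x0"
      unfolding V_def
    proof (rule mollify_mono[OF E v(1) _ c\<eta> \<eta>(2)])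
      fix x assume "x \<in> E" "\<eta> (x - x0) \<noteq> 0"
      then have "dist x x0 < d" using \<eta>(4)[of "x - x0"] d by (simp add: dist_norm r_def)
      moreover have "x \<in> closure E" "x0 \<in> closure E" using \<open>x \<in> E\<close> x0 closure_subset by auto
      ultimately have "dist (v x) (v x0) < m / 4" using d(2) by blast
      then show "v x \<le> - (3 * m / 4)" by (simp add: dist_real_def m_def)
    qed simp
    ultimately have "- (m / 4) * I \<le> V y" "V x0 \<le> - (3 * m / 4) * I"
      using mollify_const[OF c\<eta> \<eta>(4) K_cball] y(1) x0K by (simp_all add: I_def)
    moreover have "V y - \<epsilon> * (norm y)\<^sup>2 \<le> V x0 - \<epsilon> * (norm x0)\<^sup>2" using y(2) x0K .
    moreover have "\<epsilon> * (norm y)\<^sup>2 \<le> m * I / 4"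
    proof -
      have "\<epsilon> * (norm y)\<^sup>2 \<le> \<epsilon> * B\<^sup>2"
        using \<epsilon>(1) B[OF K_E[OF y(1)]] by (intro mult_left_mono power_mono) auto
      then show ?thesis using \<epsilon>(2) by simp
    qed
    moreover have "0 \<le> \<epsilon> * (norm x0)\<^sup>2" using \<epsilon>(1) by simp
    moreover have "0 < m * I" using m I by simp
    ultimately show False by simp
  next
    case False
    then have gt: "0 < infdist y (- E) - r" using y(1) by (simp add: K_def)
    have "\<forall>\<^sub>F h in at_right 0. (\<Sum>i\<in>UNIV. V (y + h *\<^sub>R axis i 1) + V (y - h *\<^sub>R axis i 1) - 2 * V y) \<le> \<epsilon> * h\<^sup>2"
      unfolding V_def by (rule mollify_second_differences[OF E v \<eta>(1) \<eta>(4) K_cball[OF y(1)] \<epsilon>(1)])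
    moreover have "\<forall>\<^sub>F h in at_right 0. h < infdist y (- E) - r"
      using gt by (intro order_tendstoD(2)[OF tendsto_ident_at])
    ultimately have "\<forall>\<^sub>F h in at_right (0::real). False"
      using eventually_at_right_less[of 0]
    proof eventually_elim
      case (elim h)
      have "2 * \<epsilon> * h\<^sup>2 \<le> V (y + h *\<^sub>R axis i 1) + V (y - h *\<^sub>R axis i 1) - 2 * V y" for i
      proof -
        have "z \<in> K" if "dist y z = h" for z
          using infdist_triangle[of y "- E" z] that elim(2) by (intro K_I) simp
        then have "y + h *\<^sub>R axis i 1 \<in> K" "y - h *\<^sub>R axis i 1 \<in> K"
          using elim(3) by (auto simp: dist_norm)
        from this[THEN y(2)]
        have "2 * \<epsilon> * ((norm (y + h *\<^sub>R axis i 1))\<^sup>2 + (norm (y - h *\<^sub>R axis i 1))\<^sup>2 - 2 * (norm y)\<^sup>2)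
          \<le> 2 * (V (y + h *\<^sub>R axis i 1) + V (y - h *\<^sub>R axis i 1) - 2 * V y)"
          by (simp add: algebra_simps)
        moreover have "(norm (y + h *\<^sub>R axis i 1))\<^sup>2 + (norm (y - h *\<^sub>R axis i 1))\<^sup>2 - 2 * (norm y)\<^sup>2 = 2 * h\<^sup>2"
          unfolding power2_norm_eq_inner
          by (simp add: inner_add_left inner_add_right inner_diff_left inner_diff_right
              inner_axis_axis power2_eq_square inner_commute)
        ultimately show ?thesis by simp
      qed
      then have "(\<Sum>i\<in>(UNIV::'n set). 2 * \<epsilon> * h\<^sup>2) \<le>
          (\<Sum>i\<in>UNIV. V (y + h *\<^sub>R axis i 1) + V (y - h *\<^sub>R axis i 1) - 2 * V y)"
        by (intro sum_mono)
      with elim(1) have "real CARD('n) * (2 * \<epsilon> * h\<^sup>2) \<le> \<epsilon> * h\<^sup>2" by simp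
      moreover have "1 * (2 * \<epsilon> * h\<^sup>2) \<le> real CARD('n) * (2 * \<epsilon> * h\<^sup>2)"
        using \<epsilon>(1) by (intro mult_right_mono) (simp_all add: Suc_leI)
      moreover have "0 < \<epsilon> * h\<^sup>2" using \<epsilon>(1) elim(3) by simp
      ultimately show False by simp
    qed
    then show False by simp
  qed
qed

section \<open>Boundaries of polygons\<close>

lemma pathstart_polygonal_path: "pathstart (polygonal_path (a # xs)) = a"
  by (cases xs rule: polygonal_path.cases) auto

lemma path_image_polygonal_path:
  "path_image (polygonal_path (a # b # xs)) =
    (\<Union>(c, d)\<in>set (zip (a # b # xs) (b # xs)). closed_segment c d)"
proof (induction xs arbitrary: a b)
  case (Cons c xs)
  have "path_image (polygonal_path (a # b # c # xs)) =
    closed_segment a b \<union> path_image (polygonal_path (b # c # xs))"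
    by (simp add: path_image_join pathstart_polygonal_path)
  then show ?case using Cons[of b c] by simp
qed simp

lemma pathfinish_polygonal_path: "pathfinish (polygonal_path (xs @ [a])) = a"
proof (induction xs rule: polygonal_path.induct)
qed (auto simp: pathfinish_def linepath_def joinpaths_def)

lemma path_image_boundary_path:
  assumes "2 \<le> length ps"
  shows "path_image (boundary_path ps) = (\<Union>(a, b)\<in>edges ps. closed_segment a b)"
proof -
  obtain a b xs where ps: "ps = a # b # xs"
    using assms by (metis One_nat_def Suc_1 Suc_le_length_iff)
  have "zip (a # b # xs @ [a]) (b # xs @ [a]) = zip (a # b # xs) (b # xs @ [a])"
    using zip_append1[of "a # b # xs" "[a]" "b # xs @ [a]"] by simp
  then show ?thesis
    using path_image_polygonal_path[of a b "xs @ [a]"]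
    by (simp add: ps boundary_path_def edges_def)
qed

lemma boundary_path_closed:
  "ps \<noteq> [] \<Longrightarrow> pathfinish (boundary_path ps) = pathstart (boundary_path ps)"
  unfolding boundary_path_def pathfinish_polygonal_path
  by (cases ps) (simp_all add: pathstart_polygonal_path)

lemma vertices_in_edges:
  assumes "a \<in> set ps" shows "\<exists>b. (a, b) \<in> edges ps"
proof -
  have "a \<in> fst ` set (zip ps (rotate1 ps))" using assms
    by (metis length_rotate1 map_fst_zip set_map)
  then show ?thesis unfolding edges_def by force
qed

lemma endpoint_in_vertices: "(a, b) \<in> edges ps \<Longrightarrow> a \<in> set ps \<and> b \<in> set ps"
  unfolding edges_def by (metis set_rotate1 set_zip_leftD set_zip_rightD)

lemma P1_on_nonneg:
  assumes "P1_on v (a, b)" "v a \<ge> 0" "v b \<ge> 0" "x \<in> closed_segment a b"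
  shows "v x \<ge> 0"
proof -
  obtain p where p: "degree p \<le> 1" "\<And>t. t \<in> {0..1} \<Longrightarrow> v (linepath a b t) = poly p t"
    using assms(1) unfolding P1_on_def by auto
  obtain t where t: "t \<in> {0..1}" "x = linepath a b t"
    using assms(4) by (metis imageE linepath_image_01)
  have *: "poly p u = coeff p 0 + coeff p 1 * u" for u
    using p(1) by (auto simp: poly_altdef le_Suc_eq coeff_eq_0)
  have "v a = poly p 0" "v b = poly p 1"
    using p(2)[of 0] p(2)[of 1] by (auto simp: linepath_def)
  then have "v x = (1 - t) * v a + t * v b"
    using p(2)[OF t(1)] t(2) * by (simp add: algebra_simps)
  then show ?thesis using assms(2,3) t(1) by simp
qed

text \<open>The Jordan curve theorem for an arbitrary Euclidean plane. The curve is homeomorphic to a circle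
  of that plane (by way of the unit circle of \<open>complex\<close>), so by the Jordan-Brouwer theorems its
  complement is disconnected and every component of the complement has the whole curve as its
  frontier; a bounded component lies inside.\<close>

lemma frontier_inside_simple_closed_path:
  fixes c :: "real \<Rightarrow> 'a::euclidean_space"
  assumes "simple_path c" "pathfinish c = pathstart c" and dim: "DIM('a) = 2"
  shows "frontier (inside (path_image c)) = path_image c"
proof (rule antisym)
  let ?\<Gamma> = "path_image c"
  show "frontier (inside ?\<Gamma>) \<subseteq> ?\<Gamma>"
    using assms(1) by (intro frontier_inside_subset closed_simple_path_image)
  have "?\<Gamma> homeomorphic sphere (0::complex) 1"
    using assms by (intro homeomorphic_simple_path_image_circle) auto
  moreover have "sphere (0::complex) 1 homeomorphic sphere (0::'a) 1"
    using dim by (intro homeomorphic_spheres') auto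
  ultimately have circle: "?\<Gamma> homeomorphic sphere (0::'a) 1"
    by (rule homeomorphic_trans)
  have "\<not> connected (- ?\<Gamma>)"
    using Jordan_Brouwer_separation[OF circle] by simp
  then obtain T where T: "T \<in> components (- ?\<Gamma>)" "bounded T"
    using cobounded_has_bounded_component[of "- ?\<Gamma>"] assms(1) dim
    by (auto simp: bounded_simple_path_image)
  have "frontier T = ?\<Gamma>"
    using Jordan_Brouwer_frontier[OF circle T(1)] dim by simp
  moreover have "T \<subseteq> inside ?\<Gamma>"
  proof
    fix x assume x: "x \<in> T"
    obtain a where "T = connected_component_set (- ?\<Gamma>) a"
      using T(1) by (auto simp: components_iff)
    then have "connected_component_set (- ?\<Gamma>) x = T"
      using x connected_component_eq[of x "- ?\<Gamma>" a] by simp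
    then show "x \<in> inside ?\<Gamma>"
      using x T in_components_subset[OF T(1)] by (auto simp: inside_def)
  qed
  ultimately have "?\<Gamma> \<subseteq> closure (inside ?\<Gamma>)"
    using closure_mono[of T "inside ?\<Gamma>"] unfolding frontier_def by (metis Diff_subset subset_trans)
  moreover have "interior (inside ?\<Gamma>) = inside ?\<Gamma>"
    using assms(1) by (simp add: interior_open open_inside closed_simple_path_image)
  ultimately show "?\<Gamma> \<subseteq> frontier (inside ?\<Gamma>)"
    using inside_no_overlap[of ?\<Gamma>] unfolding frontier_def by blast
qed

section \<open>Virtual element functions\<close>

theorem lemma3p1:
  fixes E :: "(real^2) set" and ps :: "(real^2) list" and \<rho> :: real and v :: "real^2 \<Rightarrow> real"
  assumes "open_polygon E ps"
    and "\<rho> > 0"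
    and "M1 \<rho> E"
    and "M2 \<rho> E ps"
    and "v \<in> V_h E ps"
  shows "v \<in> K_h E ps \<longleftrightarrow> (\<forall>a\<in>set ps. v a \<ge> 0)"
proof -
  let ?\<Gamma> = "path_image (boundary_path ps)"
  have ps: "2 \<le> length ps" "ps \<noteq> []" and simple: "simple_path (boundary_path ps)" and E: "E = inside ?\<Gamma>"
    using assms(1) by (auto simp: open_polygon_def)
  have \<Gamma>: "?\<Gamma> = (\<Union>(a, b)\<in>edges ps. closed_segment a b)"
    using path_image_boundary_path[OF ps(1)] .
  have Jordan: "open E" "bounded E" "frontier E = ?\<Gamma>"
    using E closed_simple_path_image[OF simple] bounded_simple_path_image[OF simple]
      frontier_inside_simple_closed_path[OF simple boundary_path_closed[OF ps(2)]]
    by (auto simp: open_inside bounded_inside)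
  have cont: "continuous_on (closure E) v" and harm: "harmonic_in v E"
    and P1: "\<And>e. e \<in> edges ps \<Longrightarrow> P1_on v e"
    using assms(5) by (auto simp: V_h_def)
  have "(\<forall>x\<in>E. v x \<ge> 0) \<longleftrightarrow> (\<forall>a\<in>set ps. v a \<ge> 0)"
  proof
    assume nonneg: "\<forall>x\<in>E. v x \<ge> 0"
    show "\<forall>a\<in>set ps. v a \<ge> 0"
    proof
      fix a assume "a \<in> set ps"
      then have "a \<in> closure E"
        using vertices_in_edges[of a ps] \<Gamma> Jordan(3) by (force simp: frontier_def)
      then show "v a \<ge> 0"
        using continuous_ge_on_closure[OF cont] nonneg by blast
    qed
  next
    assume vertices: "\<forall>a\<in>set ps. v a \<ge> 0"
    have "v x \<ge> 0" if "x \<in> frontier E" for x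
    proof -
      obtain a b where "(a, b) \<in> edges ps" "x \<in> closed_segment a b"
        using \<open>x \<in> frontier E\<close> Jordan(3) \<Gamma> by auto
      then show ?thesis
        using P1_on_nonneg[of v a b x] P1 endpoint_in_vertices[of a b ps] vertices by blast
    qed
    then show "\<forall>x\<in>E. v x \<ge> 0"
      using weak_minimum_principle[OF Jordan(1,2) cont harm] by blast
  qed
  then show ?thesis using assms(5) by (simp add: K_h_def)
qed

end
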